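(* Let $\phi\in\Phi$, let $\xi$ be a centered random variable with $\xi\in B(\phi)$, and let $\xi_1,\xi_2,\ldots$ be independent copies of $\xi$. Put $$\hat\phi(\lambda)=\sup_{n\ge1}\ \sup_{(a_1,\ldots,a_n)\in D(n)}\ \sum_{j=1}^n\phi(\lambda a_j),\qquad |\lambda|<\lambda_0 .$$ Then $$\sup_{n\ge 1}\ \sup_{(a_1,\ldots,a_n)\in D(n)}\ \Big\|\sum_{k=1}^n a_k\xi_k\Big\|_{B(\hat\phi)}\le\|\xi\|_{B(\phi)} .$$
   Context: All random variables are real-valued and defined on a sufficiently rich probability space. For $n\ge1$, $D(n)=\{(a_1,\ldots,a_n)\in\mathbb{R}^n:\ \sum_{k=1}^n a_k^2=1\}$. $\Phi$ is the set of all even, twice continuously differentiable, convex functions $\phi:(-\lambda_0,\lambda_0)\to\mathbb{R}$, where $\lambda_0=\lambda_0(\phi)\in(0,\infty]$, that are strictly increasing on $[0,\lambda_0)$, satisfy $\phi(\lambda)\asymp\lambda^2$ as $\lambda\to0$ (two-sided bounds by positive constants times $\lambda^2$), and, if $\lambda_0=\infty$, satisfy $\phi(\lambda)/\lambda\to\infty$ as $\lambda\to\infty$. For a function $g$ on $(-\lambda_0,\lambda_0)$ (here $g=\phi$ or $g=\hat\phi$, with the same $\lambda_0$), a random variable $\zeta$ belongs to $B(g)$ if there is a finite $\tau\ge0$ with $\mathbf{E}\exp(\lambda\zeta)\le\exp(g(\lambda\tau))$ for all $|\lambda|<\lambda_0$, where $g$ is read as $+\infty$ outside $(-\lambda_0,\lambda_0)$.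 The minimal (infimal) such $\tau$ is denoted $\|\zeta\|_{B(g)}$. *)

theory Defs
  imports "HOL-Probability.Probability"
begin

text \<open>
  A function on \<open>(-l0, l0)\<close> with \<open>l0\<close> in \<open>(0, \<infinity>]\<close> is a total function on the reals together with
  \<open>l0 :: ereal\<close>; its values off \<open>sym_ival l0\<close> are never used.
\<close>

definition sym_ival :: "ereal \<Rightarrow> real set" where
  "sym_ival l0 = {x. ereal \<bar>x\<bar> < l0}"

definition twice_cont_diff_on :: "real set \<Rightarrow> (real \<Rightarrow> real) \<Rightarrow> bool" where
  "twice_cont_diff_on I f \<longleftrightarrow>
     (\<exists>f' f''. (\<forall>x\<in>I. (f has_real_derivative f' x) (at x) \<and> (f' has_real_derivative f'' x) (at x)) \<and>
        continuous_on I f'')"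

definition Phi :: "ereal \<Rightarrow> (real \<Rightarrow> real) set" where
  "Phi l0 = {\<phi>.
     0 < l0 \<and>
     (\<forall>x\<in>sym_ival l0. \<phi> (- x) = \<phi> x) \<and>
     twice_cont_diff_on (sym_ival l0) \<phi> \<and>
     convex_on (sym_ival l0) \<phi> \<and>
     strict_mono_on (sym_ival l0 \<inter> {0..}) \<phi> \<and>
     (\<exists>c>0. \<exists>C>0. \<forall>\<^sub>F x in at 0. c * x\<^sup>2 \<le> \<phi> x \<and> \<phi> x \<le> C * x\<^sup>2) \<and>
     (l0 = \<infinity> \<longrightarrow> filterlim (\<lambda>x. \<phi> x / x) at_top at_top)}"

text \<open>Vectors in \<open>\<real>\<^sup>n\<close> are functions that are \<open>undefined\<close> outside \<open>{1..n}\<close>.\<close>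

definition D :: "nat \<Rightarrow> (nat \<Rightarrow> real) set" where
  "D n = {a \<in> {1..n} \<rightarrow>\<^sub>E UNIV. (\<Sum>k=1..n. (a k)\<^sup>2) = 1}"

text \<open>
  The suprema are taken in the reals; for \<open>\<phi> \<in> Phi l0\<close> and \<open>l \<in> sym_ival l0\<close> they are over
  bounded sets, see \<open>phi_hat_bounded\<close> below.
\<close>

definition phi_hat :: "(real \<Rightarrow> real) \<Rightarrow> real \<Rightarrow> real" where
  "phi_hat \<phi> l = (SUP n\<in>{1..}. SUP a\<in>D n. \<Sum>j=1..n. \<phi> (l * a j))"

text \<open>\<open>exp (g x)\<close>, where \<open>g\<close> is \<open>+\<infinity>\<close> outside \<open>(-l0, l0)\<close>.\<close>

definition exp_ext :: "ereal \<Rightarrow> (real \<Rightarrow> real) \<Rightarrow> real \<Rightarrow> ennreal" where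
  "exp_ext l0 g x = (if x \<in> sym_ival l0 then ennreal (exp (g x)) else \<infinity>)"

definition B_bounds :: "'a measure \<Rightarrow> ereal \<Rightarrow> (real \<Rightarrow> real) \<Rightarrow> ('a \<Rightarrow> real) \<Rightarrow> real set" where
  "B_bounds M l0 g \<zeta> = {\<tau>. 0 \<le> \<tau> \<and>
     (\<forall>l\<in>sym_ival l0. (\<integral>\<^sup>+\<omega>. ennreal (exp (l * \<zeta> \<omega>)) \<partial>M) \<le> exp_ext l0 g (l * \<tau>))}"

definition B_class :: "'a measure \<Rightarrow> ereal \<Rightarrow> (real \<Rightarrow> real) \<Rightarrow> ('a \<Rightarrow> real) set" where
  "B_class M l0 g = {\<zeta> \<in> borel_measurable M. B_bounds M l0 g \<zeta> \<noteq> {}}"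

text \<open>
  The infimum over the empty set is \<open>\<infinity>\<close>, so for a random variable \<open>\<zeta>\<close> the norm is finite
  exactly when \<open>\<zeta> \<in> B_class M l0 g\<close>.
\<close>

definition B_norm :: "'a measure \<Rightarrow> ereal \<Rightarrow> (real \<Rightarrow> real) \<Rightarrow> ('a \<Rightarrow> real) \<Rightarrow> ereal" where
  "B_norm M l0 g \<zeta> = (INF \<tau>\<in>B_bounds M l0 g \<zeta>. ereal \<tau>)"

lemma phi_quadratic_bound:
  assumes "\<phi> \<in> Phi l0" "l \<in> sym_ival l0"
  shows "\<exists>K\<ge>0. \<forall>x. \<bar>x\<bar> \<le> \<bar>l\<bar> \<longrightarrow> \<phi> x \<le> K * x\<^sup>2"
proof -
  let ?I = "sym_ival l0"
  have pos: "0 < l0" and ev: "\<And>x. x \<in> ?I \<Longrightarrow> \<phi> (- x) = \<phi> x"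
    and mono: "strict_mono_on (?I \<inter> {0..}) \<phi>" and tw: "twice_cont_diff_on ?I \<phi>"
    using assms(1) by (auto simp: Phi_def)
  obtain c C where cC: "c > 0" "C > 0"
    and near: "\<forall>\<^sub>F x in at 0. c * x\<^sup>2 \<le> \<phi> x \<and> \<phi> x \<le> C * x\<^sup>2"
    using assms(1) by (auto simp: Phi_def)
  have zI: "0 \<in> ?I" using pos by (simp add: sym_ival_def zero_ereal_def)
  have "isCont \<phi> 0"
    using tw zI unfolding twice_cont_diff_on_def by (meson DERIV_isCont)
  then have l1: "(\<phi> \<longlongrightarrow> \<phi> 0) (at 0)" by (simp add: isCont_def)
  have l2: "(\<phi> \<longlongrightarrow> 0) (at 0)"
  proof (rule tendsto_sandwich)
    show "\<forall>\<^sub>F x in at 0. c * x\<^sup>2 \<le> \<phi> x" "\<forall>\<^sub>F x in at 0. \<phi> x \<le> C * x\<^sup>2"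
      using near by (auto elim: eventually_mono)
    show "((\<lambda>x. c * x\<^sup>2) \<longlongrightarrow> 0) (at 0)" "((\<lambda>x. C * x\<^sup>2) \<longlongrightarrow> 0) (at 0)"
      by (auto intro!: tendsto_eq_intros)
  qed
  have z: "\<phi> 0 = 0" using tendsto_unique[OF _ l1 l2] by simp
  obtain d where d: "d > 0" "\<And>x. x \<noteq> 0 \<Longrightarrow> \<bar>x\<bar> < d \<Longrightarrow> \<phi> x \<le> C * x\<^sup>2"
    using near by (auto simp: eventually_at dist_real_def)
  define K where "K = C + \<bar>\<phi> \<bar>l\<bar>\<bar> / d\<^sup>2"
  have "\<phi> x \<le> K * x\<^sup>2" if x: "\<bar>x\<bar> \<le> \<bar>l\<bar>" for x
  proof (cases "\<bar>x\<bar> < d")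
    case True
    have "\<phi> x \<le> C * x\<^sup>2" using d(2)[of x] True z by (cases "x = 0") auto
    also have "\<dots> \<le> K * x\<^sup>2" by (intro mult_right_mono) (auto simp: K_def)
    finally show ?thesis .
  next
    case False
    have lI: "\<bar>l\<bar> \<in> ?I" using assms(2) by (simp add: sym_ival_def)
    have xI: "\<bar>x\<bar> \<in> ?I" using x assms(2) by (auto simp: sym_ival_def intro: le_less_trans[of _ "ereal \<bar>l\<bar>"])
    have "\<phi> x = \<phi> \<bar>x\<bar>" using ev[OF xI] by (cases "x \<ge> 0") auto
    also have "\<dots> \<le> \<phi> \<bar>l\<bar>"
      using strict_mono_onD[OF mono, of "\<bar>x\<bar>" "\<bar>l\<bar>"] x xI lI by (cases "\<bar>x\<bar> = \<bar>l\<bar>") auto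
    also have "\<dots> \<le> \<bar>\<phi> \<bar>l\<bar>\<bar> / d\<^sup>2 * x\<^sup>2"
    proof -
      have "d\<^sup>2 \<le> x\<^sup>2" using False d(1) by (simp add: abs_le_square_iff[symmetric])
      then have "1 \<le> x\<^sup>2 / d\<^sup>2" using d(1) by simp
      then have "\<bar>\<phi> \<bar>l\<bar>\<bar> * 1 \<le> \<bar>\<phi> \<bar>l\<bar>\<bar> * (x\<^sup>2 / d\<^sup>2)" by (intro mult_left_mono) auto
      then show ?thesis by simp
    qed
    also have "\<dots> \<le> K * x\<^sup>2" using cC by (intro mult_right_mono) (auto simp: K_def)
    finally show ?thesis .
  qed
  moreover have "K \<ge> 0" using cC by (simp add: K_def)
  ultimately show ?thesis by blast
qed

lemma phi_hat_bounded:
  assumes "\<phi> \<in> Phi l0" "l \<in> sym_ival l0"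
  shows "\<exists>B. \<forall>n. \<forall>a\<in>D n. (\<Sum>j=1..n. \<phi> (l * a j)) \<le> B"
proof -
  obtain K where K: "K \<ge> 0" "\<And>x. \<bar>x\<bar> \<le> \<bar>l\<bar> \<Longrightarrow> \<phi> x \<le> K * x\<^sup>2"
    using phi_quadratic_bound[OF assms] by blast
  have "(\<Sum>j=1..n. \<phi> (l * a j)) \<le> K * l\<^sup>2" if a: "a \<in> D n" for n a
  proof -
    have s: "(\<Sum>k=1..n. (a k)\<^sup>2) = 1" using a by (simp add: D_def)
    have "\<bar>a j\<bar> \<le> 1" if "j \<in> {1..n}" for j
    proof -
      have "(a j)\<^sup>2 \<le> (\<Sum>k=1..n. (a k)\<^sup>2)" using that by (intro member_le_sum) auto
      then show ?thesis using s by (simp add: abs_square_le_1)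
    qed
    then have "(\<Sum>j=1..n. \<phi> (l * a j)) \<le> (\<Sum>j=1..n. K * (l * a j)\<^sup>2)"
      by (intro sum_mono K(2)) (simp add: abs_mult mult_left_le)
    also have "\<dots> = K * l\<^sup>2 * (\<Sum>j=1..n. (a j)\<^sup>2)"
      by (simp add: sum_distrib_left power_mult_distrib mult.assoc)
    finally show ?thesis using s by simp
  qed
  then show ?thesis by blast
qed

end

theory Submission
  imports Defs
begin

text \<open>Every \<tau> admissible for \<xi> with respect to \<phi> is admissible, unchanged, for
  each normalized sum with respect to \<open>phi_hat \<phi>\<close>. By independence the moment
  generating function of the sum at \<open>l\<close> is the product of those of \<xi> at
  \<open>l * a k\<close>. Each factor is at most \<open>exp (\<phi> (l * \<tau> * a k))\<close>, so
  the exponents add up to one of the sums whose supremum defines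
  \<open>phi_hat \<phi> (l * \<tau>)\<close>. This is \<open>B_bounds_subset_B_bounds_sum\<close>,
  with \<open>sum_le_phi_hat\<close> for the last estimate; taking infima compares the
  norms.\<close>

text \<open>A real supremum dominates its members only over a set bounded above. Both nested suprema
  are controlled by the single bound from \<open>phi_hat_bounded\<close>, uniform in the dimension
  and the vector.\<close>

lemma sum_le_phi_hat:
  assumes \<phi>: "\<phi> \<in> Phi l0" and l: "l \<in> sym_ival l0" and n: "1 \<le> n" and a: "a \<in> D n"
  shows "(\<Sum>j=1..n. \<phi> (l * a j)) \<le> phi_hat \<phi> l"
proof -
  obtain B where B: "\<And>m b. b \<in> D m \<Longrightarrow> (\<Sum>j=1..m. \<phi> (l * b j)) \<le> B"
    using phi_hat_bounded[OF \<phi> l] by blast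
  \<comment> \<open>Bounding the inner suprema by \<open>B\<close> requires nonempty index sets. The
    first unit vector serves as witness; \<open>D 0\<close> is empty, hence the condition on
    \<open>m\<close>.\<close>
  have D_nonempty: "D m \<noteq> {}" if "1 \<le> m" for m
  proof -
    let ?e = "restrict (\<lambda>k. if k = 1 then 1 else 0 :: real) {1..m}"
    have "(\<Sum>k=1..m. (?e k)\<^sup>2) = (\<Sum>k=1..m. if k = 1 then 1 else 0)"
      by (intro sum.cong) auto
    then have "?e \<in> D m"
      using that by (simp add: D_def)
    then show ?thesis by blast
  qed
  have "(\<Sum>j=1..n. \<phi> (l * a j)) \<le> (SUP b\<in>D n. \<Sum>j=1..n. \<phi> (l * b j))"
    using a B by (intro cSUP_upper bdd_aboveI2)
  also have "\<dots> \<le> phi_hat \<phi> l"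
    unfolding phi_hat_def using n B D_nonempty
    by (intro cSUP_upper[where f = "\<lambda>m. SUP b\<in>D m. \<Sum>j=1..m. \<phi> (l * b j)"]
        bdd_aboveI2[where M = B] cSUP_least) auto
  finally show ?thesis .
qed

lemma mult_mem_sym_ival:
  assumes "x \<in> sym_ival l0" and "\<bar>c\<bar> \<le> 1"
  shows "x * c \<in> sym_ival l0"
proof -
  have "ereal \<bar>x * c\<bar> \<le> ereal \<bar>x\<bar>"
    using assms(2) by (simp add: abs_mult mult_left_le)
  then show ?thesis
    using assms(1) by (simp add: sym_ival_def le_less_trans[of _ "ereal \<bar>x\<bar>"])
qed

lemma D_abs_le_1:
  assumes "a \<in> D n" and "k \<in> {1..n}"
  shows "\<bar>a k\<bar> \<le> 1"
proof -
  have "(a k)\<^sup>2 \<le> (\<Sum>j=1..n. (a j)\<^sup>2)"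
    using assms(2) by (intro member_le_sum) auto
  then show ?thesis
    using assms(1) by (simp add: D_def abs_square_le_1)
qed

text \<open>Working with the sets of admissible \<tau> avoids asking whether the infimum defining
  the norm is attained.\<close>

lemma (in prob_space) B_bounds_subset_B_bounds_sum:
  assumes \<phi>: "\<phi> \<in> Phi l0" and \<xi>: "\<xi> \<in> borel_measurable M"
    and indep: "indep_vars (\<lambda>_. borel) X {1..n}"
    and distr: "\<And>k. k \<in> {1..n} \<Longrightarrow> distr M borel (X k) = distr M borel \<xi>"
    and n: "1 \<le> n" and a: "a \<in> D n"
  shows "B_bounds M l0 \<phi> \<xi> \<subseteq> B_bounds M l0 (phi_hat \<phi>) (\<lambda>\<omega>. \<Sum>k=1..n. a k * X k \<omega>)"
proof
  fix \<tau> assume "\<tau> \<in> B_bounds M l0 \<phi> \<xi>"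
  then have \<tau>: "0 \<le> \<tau>" and bound: "\<And>l. l \<in> sym_ival l0 \<Longrightarrow>
      (\<integral>\<^sup>+\<omega>. ennreal (exp (l * \<xi> \<omega>)) \<partial>M) \<le> exp_ext l0 \<phi> (l * \<tau>)"
    by (auto simp: B_bounds_def)
  have X: "X k \<in> borel_measurable M" if "k \<in> {1..n}" for k
    using indep that by (auto simp: indep_vars_def)
  have "(\<integral>\<^sup>+\<omega>. ennreal (exp (l * (\<Sum>k=1..n. a k * X k \<omega>))) \<partial>M) \<le> exp_ext l0 (phi_hat \<phi>) (l * \<tau>)"
    if l: "l \<in> sym_ival l0" for l
  proof (cases "l * \<tau> \<in> sym_ival l0")
    \<comment> \<open>Outside the interval the right-hand side is \<infinity>.\<close>
    case False
    then show ?thesis by (simp add: exp_ext_def)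
  next
    case True
    have "(\<integral>\<^sup>+\<omega>. ennreal (exp (l * (\<Sum>k=1..n. a k * X k \<omega>))) \<partial>M)
        = (\<integral>\<^sup>+\<omega>. (\<Prod>k=1..n. ennreal (exp (l * a k * X k \<omega>))) \<partial>M)"
      by (simp add: prod_ennreal exp_sum sum_distrib_left mult.assoc)
    \<comment> \<open>For nonnegative integrals independence gives the product formula even when
      values may be infinite, so no integrability has to be checked.\<close>
    also have "\<dots> = (\<Prod>k=1..n. \<integral>\<^sup>+\<omega>. ennreal (exp (l * a k * X k \<omega>)) \<partial>M)"
      by (intro indep_vars_nn_integral indep_vars_compose2[OF indep]) auto
    also have "\<dots> \<le> (\<Prod>k=1..n. ennreal (exp (\<phi> (l * \<tau> * a k))))"
    proof (intro prod_mono_ennreal)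
      fix k assume k: "k \<in> {1..n}"
      have "(\<integral>\<^sup>+\<omega>. ennreal (exp (l * a k * X k \<omega>)) \<partial>M)
          = (\<integral>\<^sup>+x. ennreal (exp (l * a k * x)) \<partial>distr M borel (X k))"
        using X[OF k] by (subst nn_integral_distr) auto
      also have "\<dots> = (\<integral>\<^sup>+\<omega>. ennreal (exp (l * a k * \<xi> \<omega>)) \<partial>M)"
        unfolding distr[OF k] using \<xi> by (subst nn_integral_distr) auto
      \<comment> \<open>The hypothesis on \<xi> is used at \<open>l * a k\<close>, which stays in
        the interval because a coordinate of a unit vector has modulus at most 1.\<close>
      also have "\<dots> \<le> exp_ext l0 \<phi> (l * a k * \<tau>)"
        by (intro bound mult_mem_sym_ival l D_abs_le_1[OF a k])
      \<comment> \<open>The same shrinking, now applied to \<open>l * \<tau>\<close>, selects the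
        finite branch of \<open>exp_ext\<close>.\<close>
      also have "\<dots> = ennreal (exp (\<phi> (l * \<tau> * a k)))"
        using mult_mem_sym_ival[OF True D_abs_le_1[OF a k]] by (simp add: exp_ext_def ac_simps)
      finally show "(\<integral>\<^sup>+\<omega>. ennreal (exp (l * a k * X k \<omega>)) \<partial>M) \<le> ennreal (exp (\<phi> (l * \<tau> * a k)))" .
    qed
    also have "\<dots> = ennreal (exp (\<Sum>k=1..n. \<phi> (l * \<tau> * a k)))"
      by (simp add: prod_ennreal exp_sum)
    also have "\<dots> \<le> ennreal (exp (phi_hat \<phi> (l * \<tau>)))"
      using sum_le_phi_hat[OF \<phi> True n a] by (intro ennreal_leI) simp
    finally show ?thesis
      using True by (simp add: exp_ext_def)
  qed
  with \<tau> show "\<tau> \<in> B_bounds M l0 (phi_hat \<phi>) (\<lambda>\<omega>. \<Sum>k=1..n. a k * X k \<omega>)"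
    by (simp add: B_bounds_def)
qed

theorem theorem3p2:
  fixes M :: "'a measure" and l0 :: ereal and \<phi> :: "real \<Rightarrow> real"
    and \<xi> :: "'a \<Rightarrow> real" and X :: "nat \<Rightarrow> 'a \<Rightarrow> real"
  assumes "prob_space M"
    and "\<phi> \<in> Phi l0"
    and "\<xi> \<in> B_class M l0 \<phi>"
    and "integrable M \<xi>" and "integral\<^sup>L M \<xi> = 0"
    and "prob_space.indep_vars M (\<lambda>_. borel) X {1..}"
    and "\<And>k. 1 \<le> k \<Longrightarrow> distr M borel (X k) = distr M borel \<xi>"
  shows "(SUP n\<in>{1..}. SUP a\<in>D n. B_norm M l0 (phi_hat \<phi>) (\<lambda>\<omega>. \<Sum>k=1..n. a k * X k \<omega>))
           \<le> B_norm M l0 \<phi> \<xi>"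
proof (intro SUP_least)
  fix n :: nat and a assume n: "n \<in> {1..}" and a: "a \<in> D n"
  interpret prob_space M by fact
  have "indep_vars (\<lambda>_. borel) X {1..n}"
    using assms(6) by (rule indep_vars_subset) auto
  then have "B_bounds M l0 \<phi> \<xi> \<subseteq> B_bounds M l0 (phi_hat \<phi>) (\<lambda>\<omega>. \<Sum>k=1..n. a k * X k \<omega>)"
    using assms(2,3,7) n a by (intro B_bounds_subset_B_bounds_sum) (auto simp: B_class_def)
  \<comment> \<open>An infimum over a larger set is smaller, so the inclusion reverses into the norm
    inequality.\<close>
  then show "B_norm M l0 (phi_hat \<phi>) (\<lambda>\<omega>. \<Sum>k=1..n. a k * X k \<omega>) \<le> B_norm M l0 \<phi> \<xi>"
    unfolding B_norm_def by (intro INF_superset_mono) auto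
qed

end
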